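(* Let $(X,(f_n))$ be a complex situation such that $f_m(f_n(x))=f_m(x)$ whenever $m<n$ and both $f_m(f_n(x))$ and $f_m(x)$ are defined. Then $(2^\omega,\mathbb{G}_1)\preceq^{inj}_c(X,A^f)$.
   Context: For a sequence $(f_n)$ of partial functions, $A^f:=\bigcup_n\mathrm{Graph}(f_n)$. A complex situation is a pair $(X,(f_n)_{n\in\omega})$ where $X$ is a nonempty Polish space, each $f_n$ is a partial continuous open map on $X$ whose domain and range are open in $X$, and $\Delta(X)\subseteq\overline{A^f}\setminus A^f$ ($\Delta(X)$ the diagonal). $(X,A)\preceq^{inj}_c(Y,B)$ means there is an injective continuous $h:X\to Y$ with $A\subseteq(h\times h)^{-1}(B)$. Let $\psi:\omega\to 2^{<\omega}$ be the bijection enumerating finite binary sequences by length and then lexicographically. Let $q_0=0$, $q_{n+1}=3\cdot 2^{q_n}$, $t_n:=\psi(n)0^{2^{q_n}-|\psi(n)|}$, $S_n:=\{2^{q_n}j:j\ge1\}$, $\theta_n(k)=k$ if $k\notin S_n$ and $\theta_n(2^{q_n}j)=2^{q_n}(2j+1)$ for $j\ge1$. For $s\in2^{<\omega}$, $N_s=\{\alpha\in 2^\omega:s\subseteq\alpha\}$. Define $g_n:N_{t_n0}\to N_{t_n1}$ by $g_n(\alpha)(k)=1$ if $k=2^{q_n}$ and $g_n(\alpha)(k)=\alpha(\theta_n(k))$ otherwise, and $\mathbb{G}_1:=\bigcup_n\mathrm{Graph}(g_n)$. *)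

theory Defs
  imports "HOL-Analysis.Analysis"
begin

text \<open>Partial maps are modelled as total functions f n together with a domain D n.\<close>

definition graph_of :: "'a set \<Rightarrow> ('a \<Rightarrow> 'b) \<Rightarrow> ('a \<times> 'b) set" where
  "graph_of D g = {(x, g x) | x. x \<in> D}"

definition Af :: "(nat \<Rightarrow> 'a set) \<Rightarrow> (nat \<Rightarrow> 'a \<Rightarrow> 'a) \<Rightarrow> ('a \<times> 'a) set" where
  "Af D f = (\<Union>n. graph_of (D n) (f n))"

text \<open>Complex situation on a Polish space (Polishness and nonemptiness come from the type class /
  HOL types being nonempty).\<close>
definition complex_situation :: "(nat \<Rightarrow> 'a::polish_space set) \<Rightarrow> (nat \<Rightarrow> 'a \<Rightarrow> 'a) \<Rightarrow> bool" where
  "complex_situation D f \<longleftrightarrow>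
     (\<forall>n. open (D n) \<and> open (f n ` D n) \<and> continuous_on (D n) (f n)
          \<and> (\<forall>U. open U \<and> U \<subseteq> D n \<longrightarrow> open (f n ` U)))
     \<and> (\<forall>x. (x, x) \<in> closure (Af D f) - Af D f)"

definition cantor_top :: "(nat \<Rightarrow> bool) topology" where
  "cantor_top = product_topology (\<lambda>_. discrete_topology UNIV) UNIV"

text \<open>psi: enumeration of finite binary sequences by length, then lexicographically.
  psi n is the binary expansion of n+1 with the leading 1 removed.\<close>
function psi :: "nat \<Rightarrow> bool list" where
  "psi n = (if n = 0 then [] else psi ((n + 1) div 2 - 1) @ [odd (n + 1)])"
  by auto
termination by (relation "Wellfounded.measure id") auto

fun q :: "nat \<Rightarrow> nat" where
  "q 0 = 0"
| "q (Suc n) = 3 * 2 ^ q n"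

definition t :: "nat \<Rightarrow> bool list" where
  "t n = psi n @ replicate (2 ^ q n - length (psi n)) False"

definition S :: "nat \<Rightarrow> nat set" where
  "S n = {2 ^ q n * j | j. j \<ge> 1}"

definition theta :: "nat \<Rightarrow> nat \<Rightarrow> nat" where
  "theta n k = (if k \<in> S n then 2 ^ q n * (2 * (k div 2 ^ q n) + 1) else k)"

definition Nbhd :: "bool list \<Rightarrow> (nat \<Rightarrow> bool) set" where
  "Nbhd s = {\<alpha>. \<forall>i < length s. \<alpha> i = s ! i}"

definition g :: "nat \<Rightarrow> (nat \<Rightarrow> bool) \<Rightarrow> (nat \<Rightarrow> bool)" where
  "g n \<alpha> = (\<lambda>k. if k = 2 ^ q n then True else \<alpha> (theta n k))"

definition G1 :: "((nat \<Rightarrow> bool) \<times> (nat \<Rightarrow> bool)) set" where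
  "G1 = (\<Union>n. graph_of (Nbhd (t n @ [False])) (g n))"

end

theory Submission
  imports Defs
begin

text \<open>
  Let M be the largest index m < n such that the domain of \<^term>\<open>g m\<close> contains \<alpha>.
  Since g m (g M \<alpha>) = g m \<alpha> for m < M, the edges \<alpha> \<mapsto> g M \<alpha> determine all others with index below n,
  and they form a forest oriented towards its roots. Two sequences are identified at stage n if the
  first \<^term>\<open>q n\<close> digits of all their iterates along the forest agree. This leaves finitely many
  vertices, and the growth of q ensures that \<^term>\<open>Nbhd (t n)\<close> lies in a single class.

  At each stage the vertices of this finite forest are sent to distinct points of X so that forest
  edges go to graphs of the given maps; by the absorption hypothesis the remaining edges follow. Such a
  family can be moved slightly: continuity pushes points towards the root and openness lifts them
  back. To pass to stage n + 1, choose y near the image of \<^term>\<open>Nbhd (t n)\<close> whose image under some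
  new map is near it too, and use one perturbed copy of the family through each of these two points.
  Absorption also yields, near every point of the domain of a given map, two points with the same
  image, so that all vertices can be made distinct. The embedding is the uniform limit of these families.
\<close>

subsection \<open>Topological preliminaries\<close>

lemma finite_imp_disjoint_open_nhds:
  fixes x :: "'w \<Rightarrow> 'a::t2_space"
  assumes "finite W" "inj_on x W"
  obtains V where "\<And>w. w \<in> W \<Longrightarrow> open (V w)" "\<And>w. w \<in> W \<Longrightarrow> x w \<in> V w"
    "disjoint_family_on V W"
proof -
  have "\<exists>P Q. u \<in> W \<longrightarrow> w \<in> W \<longrightarrow> u \<noteq> w \<longrightarrow>
      open P \<and> open Q \<and> x u \<in> P \<and> x w \<in> Q \<and> P \<inter> Q = {}" for u w
    using hausdorff[of "x u" "x w"] assms(2) by (metis inj_onD)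
  then obtain P Q where "\<forall>u w. u \<in> W \<longrightarrow> w \<in> W \<longrightarrow> u \<noteq> w \<longrightarrow>
      open (P u w) \<and> open (Q u w) \<and> x u \<in> P u w \<and> x w \<in> Q u w \<and> P u w \<inter> Q u w = {}"
    by metis
  then have separated: "open (P u w)" "open (Q u w)" "x u \<in> P u w" "x w \<in> Q u w"
      "P u w \<inter> Q u w = {}" if "u \<in> W" "w \<in> W" "u \<noteq> w" for u w
    using that by blast+
  define V where "V w = (\<Inter>u\<in>W - {w}. P w u \<inter> Q u w)" for w
  have "open (V w)" if "w \<in> W" for w
    unfolding V_def using that assms(1) separated(1,2) by (intro open_INT ballI open_Int) auto
  moreover have "x w \<in> V w" if "w \<in> W" for w
    using that separated(3,4) by (auto simp: V_def)
  moreover have "V u \<inter> V w = {}" if "u \<in> W" "w \<in> W" "u \<noteq> w" for u w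
    using separated(5)[OF that] that by (auto simp: V_def)
  ultimately show thesis
    using that[of V] by (simp add: disjoint_family_on_def)
qed

lemma eventually_ball_subset:
  fixes K :: "'a::metric_space set"
  assumes "compact K" "open U" "K \<subseteq> U"
  shows "\<forall>\<^sub>F e in at_right 0. \<forall>y\<in>K. ball y e \<subseteq> U"
proof -
  obtain c where "c > 0" "(\<Union>y\<in>K. ball y c) \<subseteq> U"
    using compact_subset_open_imp_ball_epsilon_subset[OF assms] .
  then have "\<forall>y\<in>K. ball y e \<subseteq> U" if "e < c" for e
    using that subset_ball[of e c] by (blast intro: less_imp_le)
  then show ?thesis
    using \<open>c > 0\<close> unfolding eventually_at_right_field by blast
qed

lemma eventually_less_dist:
  fixes A :: "'a::metric_space set"
  assumes "finite A"
  shows "\<forall>\<^sub>F e in at_right 0. \<forall>y\<in>A. \<forall>z\<in>A. y \<noteq> z \<longrightarrow> e < dist y z"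
proof -
  have "uniform_discrete A"
    using assms by (induction rule: finite_induct) (auto simp: uniform_discrete_insert)
  then obtain c where "c > 0" "\<forall>y\<in>A. \<forall>z\<in>A. dist y z < c \<longrightarrow> y = z"
    by (auto simp: uniform_discrete_def)
  then show ?thesis
    unfolding eventually_at_right_field by (intro exI[of _ c]) force
qed

lemma halving_tendsto_zero:
  fixes e :: "nat \<Rightarrow> real"
  assumes "\<And>n. 0 \<le> e n" "\<And>n. e (Suc n) \<le> e n / 2"
  shows "e \<longlonglongrightarrow> 0"
proof (rule tendsto_sandwich[where f="\<lambda>_. 0"])
  have "e n \<le> e 0 * (1 / 2) ^ n" for n
  proof (induction n)
    case (Suc n)
    then show ?case using assms(2)[of n] by simp
  qed simp
  then show "\<forall>\<^sub>F n in sequentially. e n \<le> e 0 * (1 / 2) ^ n" by simp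
  show "(\<lambda>n. e 0 * (1 / 2) ^ n) \<longlonglongrightarrow> 0"
    by (intro tendsto_mult_right_zero LIMSEQ_power_zero) simp
qed (use assms(1) in simp_all)

lemma dist_le_halving_errors:
  fixes x :: "nat \<Rightarrow> 'a::metric_space"
  assumes "\<And>n. 0 \<le> e n" "\<And>n. e (Suc n) \<le> e n / 2" "\<And>n. dist (x (Suc n)) (x n) \<le> e n / 4"
  shows "dist (x (k + n)) (x n) \<le> e n / 2"
proof -
  have "dist (x (k + n)) (x n) \<le> e n / 2 - e (k + n) / 2"
  proof (induction k)
    case (Suc k)
    then show ?case
      using assms(2,3)[of "k + n"] dist_triangle[of "x (Suc k + n)" "x n" "x (k + n)"] by simp
  qed simp
  then show ?thesis using assms(1)[of "k + n"] by simp
qed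

lemma uniform_limit_halving_errors:
  fixes x :: "nat \<Rightarrow> 'b \<Rightarrow> 'a::complete_space"
  assumes nonneg: "\<And>n. 0 \<le> e n" and half: "\<And>n. e (Suc n) \<le> e n / 2"
    and close: "\<And>n b. dist (x (Suc n) b) (x n b) \<le> e n / 4"
  obtains h where "\<And>n b. dist (h b) (x n b) \<le> e n / 2" "uniform_limit UNIV x h sequentially"
proof -
  have dist_tail: "dist (x (k + n) b) (x n b) \<le> e n / 2" for n k b
    using nonneg half close by (rule dist_le_halving_errors)
  have small: "\<forall>\<^sub>F n in sequentially. e n < d" if "d > 0" for d
    using halving_tendsto_zero[of e, OF nonneg half] that by (rule order_tendstoD(2))
  have "uniformly_convergent_on UNIV x"
    unfolding uniformly_convergent_eq_Cauchy uniformly_Cauchy_on_def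
  proof (intro allI impI)
    fix d :: real assume "d > 0"
    then obtain n where n: "e n < d"
      using eventually_happens'[OF sequentially_bot small] by blast
    have near: "dist (x k b) (x n b) < d / 2" if "n \<le> k" for k b
      using dist_tail[of "k - n" n b] that n by simp
    have "dist (x k b) (x l b) < d" if "n \<le> k" "n \<le> l" for k l b
      using near[OF that(1)] near[OF that(2)] by (rule dist_triangle_half_l)
    then show "\<exists>n. \<forall>b\<in>UNIV. \<forall>k\<ge>n. \<forall>l\<ge>n. dist (x k b) (x l b) < d" by blast
  qed
  then obtain h where h: "uniform_limit UNIV x h sequentially"
    by (auto simp: uniformly_convergent_on_def)
  have "dist (h b) (x n b) \<le> e n / 2" for n b
  proof (rule LIMSEQ_le_const2)
    show "(\<lambda>k. dist (x (k + n) b) (x n b)) \<longlonglongrightarrow> dist (h b) (x n b)"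
      using tendsto_uniform_limitI[OF h UNIV_I, of b]
      by (intro tendsto_dist tendsto_const LIMSEQ_ignore_initial_segment)
  qed (use dist_tail in blast)
  then show thesis using h by (rule that)
qed

subsection \<open>Finite forests mapped along partial open maps\<close>

text \<open>\<^term>\<open>E w = Some (i, v)\<close> means that v is the parent of w, along an edge with label i.\<close>
inductive forest :: "('w \<Rightarrow> ('i \<times> 'w) option) \<Rightarrow> 'w set \<Rightarrow> bool" for E where
  empty: "forest E {}"
| leaf: "forest E W \<Longrightarrow> l \<notin> W \<Longrightarrow> \<forall>i v. E l = Some (i, v) \<longrightarrow> v \<in> W \<Longrightarrow> forest E (insert l W)"

lemma forest_finite: "forest E W \<Longrightarrow> finite W"
  by (induction rule: forest.induct) auto

lemma forest_parent_mem: "forest E W \<Longrightarrow> w \<in> W \<Longrightarrow> E w = Some (i, v) \<Longrightarrow> v \<in> W"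
  by (induction rule: forest.induct) auto

lemma forest_if_height_decreasing:
  fixes height :: "'w \<Rightarrow> nat"
  assumes "finite W"
    and "\<And>w i v. w \<in> W \<Longrightarrow> E w = Some (i, v) \<Longrightarrow> v \<in> W \<and> height v < height w"
  shows "forest E W"
  using assms
proof (induction rule: finite_ranking_induct[where f=height])
  case empty
  show ?case by (rule forest.empty)
next
  case (insert l W)
  show ?case
  proof (cases "l \<in> W")
    case True
    then show ?thesis using insert by (simp add: insert_absorb)
  next
    case False
    have parent: "v \<in> W" if "w \<in> insert l W" "E w = Some (i, v)" for w i v
      using insert.prems[OF that] insert.hyps(2) that(1) by (fastforce simp: not_less)
    have "forest E W"
      by (rule insert.IH) (use parent insert.prems in blast)
    then show ?thesis
      using False parent by (intro forest.leaf) auto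
  qed
qed

lemma mem_graph_of [simp]: "(x, y) \<in> graph_of A h \<longleftrightarrow> x \<in> A \<and> y = h x"
  by (auto simp: graph_of_def)

locale open_partial_maps =
  fixes D :: "'i \<Rightarrow> 'a::topological_space set" and f :: "'i \<Rightarrow> 'a \<Rightarrow> 'a"
  assumes open_domain: "open (D i)"
    and continuous_on_domain: "continuous_on (D i) (f i)"
    and open_image: "open U \<Longrightarrow> U \<subseteq> D i \<Longrightarrow> open (f i ` U)"
begin

lemma tendsto_f: "x \<in> D i \<Longrightarrow> (f i \<longlongrightarrow> f i x) (nhds x)"
  using continuous_on_domain[of i] at_within_open[OF _ open_domain, of x i]
  by (metis continuous_on_def tendsto_at_iff_tendsto_nhds)

lemma open_preimage: "open U \<Longrightarrow> open (D i \<inter> f i -` U)"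
  using continuous_on_domain open_domain by (rule continuous_open_preimage)

definition realizes :: "('w \<Rightarrow> ('i \<times> 'w) option) \<Rightarrow> 'w set \<Rightarrow> ('w \<Rightarrow> 'a) \<Rightarrow> bool" where
  "realizes E W x \<longleftrightarrow> (\<forall>w\<in>W. \<forall>i v. E w = Some (i, v) \<longrightarrow> (x w, x v) \<in> graph_of (D i) (f i))"

lemma realizes_insert_leaf:
  assumes "forest E W" "l \<notin> W" "\<forall>i v. E l = Some (i, v) \<longrightarrow> v \<in> W"
  shows "realizes E (insert l W) (x(l := y)) \<longleftrightarrow>
    realizes E W x \<and> (\<forall>i v. E l = Some (i, v) \<longrightarrow> (y, x v) \<in> graph_of (D i) (f i))"
proof -
  have "v \<noteq> l" if "w \<in> insert l W" "E w = Some (i, v)" for w i v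
    using that assms(2,3) forest_parent_mem[OF assms(1)] by blast
  then show ?thesis
    using assms(2) by (auto simp: realizes_def)
qed

lemma realizes_lift_leaf:
  assumes "forest E W" "l \<notin> W" "\<forall>i v. E l = Some (i, v) \<longrightarrow> v \<in> W"
    and "realizes E (insert l W) x"
    and U: "\<And>w. w \<in> insert l W \<Longrightarrow> open (U w)" "\<And>w. w \<in> insert l W \<Longrightarrow> x w \<in> U w"
  obtains U' where "\<And>w. w \<in> W \<Longrightarrow> open (U' w)" "\<And>w. w \<in> W \<Longrightarrow> x w \<in> U' w" "\<And>w. U' w \<subseteq> U w"
    "\<And>x'. realizes E W x' \<Longrightarrow> (\<And>w. w \<in> W \<Longrightarrow> x' w \<in> U' w) \<Longrightarrow>
      \<exists>y\<in>U l. realizes E (insert l W) (x'(l := y))"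
proof (cases "E l")
  case None
  have "\<exists>y\<in>U l. realizes E (insert l W) (x'(l := y))" if "realizes E W x'" for x'
    using that U(2) None by (intro bexI[of _ "x l"]) (simp_all add: realizes_insert_leaf[OF assms(1-3)])
  then show thesis by (intro that[of U]) (use U in auto)
next
  case (Some edge)
  then obtain i v where edge: "E l = Some (i, v)" by (cases edge) simp
  define U' where "U' = U(v := U v \<inter> f i ` (U l \<inter> D i))"
  have image: "x l \<in> D i" "x v = f i (x l)"
    using assms(4) edge by (auto simp: realizes_def)
  have "open (U' w)" if "w \<in> W" for w
    using U(1) that open_domain by (auto simp: U'_def intro!: open_Int open_image)
  moreover have "x w \<in> U' w" if "w \<in> W" for w
    using image U(2)[of l] U(2)[of w] that by (auto simp: U'_def)
  moreover have "U' w \<subseteq> U w" for w by (simp add: U'_def)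
  moreover have "\<exists>y\<in>U l. realizes E (insert l W) (x'(l := y))"
    if "realizes E W x'" "\<And>w. w \<in> W \<Longrightarrow> x' w \<in> U' w" for x'
    using that(1) that(2)[of v] assms(3) edge
    by (auto simp: realizes_insert_leaf[OF assms(1-3)] U'_def)
  ultimately show thesis by (rule that)
qed

text \<open>Continuity pushes a displacement from a vertex to its parent, openness lifts it back to the
  children.\<close>
lemma realizes_perturb_at_leaf:
  assumes forest: "forest E W" "l \<notin> W" "\<forall>i v. E l = Some (i, v) \<longrightarrow> v \<in> W"
    and x: "realizes E (insert l W) x"
    and U: "\<And>w. w \<in> insert l W \<Longrightarrow> open (U w)" "\<And>w. w \<in> insert l W \<Longrightarrow> x w \<in> U w"
    and parent: "\<And>v. v \<in> W \<Longrightarrow>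
      \<forall>\<^sub>F y in nhds (x v). \<exists>x'. realizes E W x' \<and> x' v = y \<and> (\<forall>w\<in>W. x' w \<in> U w)"
  shows "\<forall>\<^sub>F y in nhds (x l). \<exists>x'. realizes E (insert l W) x' \<and> x' l = y \<and> (\<forall>w\<in>insert l W. x' w \<in> U w)"
proof -
  have "\<forall>\<^sub>F y in nhds (x l). \<exists>x'. realizes E (insert l W) (x'(l := y)) \<and> (\<forall>w\<in>W. x' w \<in> U w)"
  proof (cases "E l")
    case None
    have "realizes E W x" using x by (simp add: realizes_def)
    then have "realizes E (insert l W) (x(l := y))" for y
      using None by (simp add: realizes_insert_leaf[OF forest])
    then show ?thesis using U(2) by (intro always_eventually) blast
  next
    case (Some edge)
    then obtain i v where edge: "E l = Some (i, v)" by (cases edge) simp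
    then have image: "x l \<in> D i" "f i (x l) = x v" "v \<in> W"
      using x forest(3) by (auto simp: realizes_def)
    have "filterlim (f i) (nhds (x v)) (nhds (x l))"
      using tendsto_f[OF image(1)] image(2) by simp
    with parent[OF image(3)]
    have "\<forall>\<^sub>F y in nhds (x l). \<exists>x'. realizes E W x' \<and> x' v = f i y \<and> (\<forall>w\<in>W. x' w \<in> U w)"
      by (rule eventually_compose_filterlim)
    moreover have "\<forall>\<^sub>F y in nhds (x l). y \<in> D i"
      using image(1) open_domain by (simp add: eventually_nhds_in_open)
    ultimately show ?thesis
      by eventually_elim (auto simp: realizes_insert_leaf[OF forest] edge)
  qed
  moreover have "\<forall>\<^sub>F y in nhds (x l). y \<in> U l"
    using U[of l] by (simp add: eventually_nhds_in_open)
  ultimately show ?thesis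
  proof eventually_elim
    case (elim y)
    then obtain x' where x': "realizes E (insert l W) (x'(l := y))" "\<forall>w\<in>W. x' w \<in> U w" by blast
    moreover have "\<forall>w\<in>insert l W. (x'(l := y)) w \<in> U w" using x'(2) elim(2) by simp
    ultimately show ?case by (metis fun_upd_same)
  qed
qed

lemma realizes_perturb_at:
  assumes "forest E W" "realizes E W x" "v \<in> W"
    and "\<And>w. w \<in> W \<Longrightarrow> open (U w)" "\<And>w. w \<in> W \<Longrightarrow> x w \<in> U w"
  shows "\<forall>\<^sub>F y in nhds (x v). \<exists>x'. realizes E W x' \<and> x' v = y \<and> (\<forall>w\<in>W. x' w \<in> U w)"
  using assms
proof (induction arbitrary: U v rule: forest.induct)
  case (leaf W l)
  have x: "realizes E W x"
    using leaf.prems(1) by (simp add: realizes_def)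
  show ?case
  proof (cases "v = l")
    case True
    have lower: "\<forall>\<^sub>F y in nhds (x u). \<exists>x'. realizes E W x' \<and> x' u = y \<and> (\<forall>w\<in>W. x' w \<in> U w)"
      if "u \<in> W" for u
      using leaf.prems(3,4) that by (intro leaf.IH x) auto
    show ?thesis
      unfolding True by (rule realizes_perturb_at_leaf[OF leaf.hyps leaf.prems(1,3,4) lower])
  next
    case False
    then have "v \<in> W" using leaf.prems(2) by simp
    obtain U' where U': "\<And>w. w \<in> W \<Longrightarrow> open (U' w)" "\<And>w. w \<in> W \<Longrightarrow> x w \<in> U' w" "\<And>w. U' w \<subseteq> U w"
      and lift: "\<And>x'. realizes E W x' \<Longrightarrow> (\<And>w. w \<in> W \<Longrightarrow> x' w \<in> U' w) \<Longrightarrow>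
        \<exists>y\<in>U l. realizes E (insert l W) (x'(l := y))"
      using realizes_lift_leaf[OF leaf.hyps leaf.prems(1,3,4)] by metis
    have "\<forall>\<^sub>F y in nhds (x v). \<exists>x'. realizes E W x' \<and> x' v = y \<and> (\<forall>w\<in>W. x' w \<in> U' w)"
      by (rule leaf.IH[OF x \<open>v \<in> W\<close> U'(1,2)])
    then show ?thesis
    proof eventually_elim
      case (elim y)
      then obtain x' where x': "realizes E W x'" "x' v = y" "\<forall>w\<in>W. x' w \<in> U' w" by blast
      then obtain z where "z \<in> U l" "realizes E (insert l W) (x'(l := z))"
        using lift by blast
      then show ?case
        using x'(2,3) U'(3) False by (intro exI[of _ "x'(l := z)"]) (auto simp: fun_upd_def)
    qed
  qed
qed simp

end

locale absorbing_maps = open_partial_maps D f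
  for D :: "nat \<Rightarrow> 'a::t2_space set" and f :: "nat \<Rightarrow> 'a \<Rightarrow> 'a" +
  assumes diagonal_limit: "(x, x) \<in> closure (Af D f)"
    and f_neq: "x \<in> D n \<Longrightarrow> f n x \<noteq> x"
    and absorb: "m < n \<Longrightarrow> x \<in> D n \<Longrightarrow> f n x \<in> D m \<Longrightarrow> x \<in> D m \<Longrightarrow> f m (f n x) = f m x"
begin

lemma recurrence:
  assumes "open U" "U \<noteq> {}"
  obtains n y where "y \<in> D n" "y \<in> U" "f n y \<in> U"
proof -
  obtain x where "x \<in> U" using assms(2) by blast
  then have "(U \<times> U) \<inter> closure (Af D f) \<noteq> {}" using diagonal_limit by blast
  then have "(U \<times> U) \<inter> Af D f \<noteq> {}"
    using open_Int_closure_eq_empty[OF open_Times[OF assms(1) assms(1)]] by blast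
  then show thesis using that by (auto simp: Af_def)
qed

lemma displaced_nhd:
  assumes "open U" "y \<in> U" "y \<in> D n"
  obtains V where "open V" "y \<in> V" "V \<subseteq> U" "f n ` V \<inter> V = {}"
proof -
  obtain P Q where PQ: "open P" "open Q" "y \<in> P" "f n y \<in> Q" "P \<inter> Q = {}"
    using hausdorff[of y "f n y"] f_neq[OF assms(3)] by metis
  show thesis
  proof (rule that)
    show "open (U \<inter> P \<inter> (D n \<inter> f n -` Q))"
      using assms(1) PQ by (intro open_Int[OF _ open_preimage]) auto
  qed (use assms PQ in auto)
qed

lemma recurrence_ge:
  assumes "open U" "U \<noteq> {}"
  obtains n y where "N \<le> n" "y \<in> D n" "y \<in> U" "f n y \<in> U"
proof -
  have "\<exists>n\<ge>N. \<exists>y\<in>D n \<inter> U. f n y \<in> U"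
    using assms
  proof (induction N arbitrary: U)
    case 0
    then show ?case by (metis IntI recurrence zero_le)
  next
    case (Suc N)
    then obtain n y where n: "n \<ge> N" "y \<in> D n" "y \<in> U" "f n y \<in> U" by blast
    show ?case
    proof (cases "n = N")
      case True
      obtain V where V: "open V" "y \<in> V" "V \<subseteq> U" "f n ` V \<inter> V = {}"
        using displaced_nhd[OF Suc.prems(1) n(3,2)] .
      then obtain k z where k: "k \<ge> N" "z \<in> D k" "z \<in> V" "f k z \<in> V"
        using Suc.IH[of V] by blast
      then have "k \<noteq> N" using V(4) True by blast
      then show ?thesis using k V(3) by (intro exI[of _ k]) auto
    qed (use n in \<open>auto intro!: exI[of _ n]\<close>)
  qed
  then show thesis using that by blast
qed

lemma two_preimages:
  assumes "open U" "U \<noteq> {}" "U \<subseteq> D n"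
  obtains y z where "y \<in> U" "z \<in> U" "y \<noteq> z" "f n y = f n z"
proof -
  obtain N y where "Suc n \<le> N" "y \<in> D N" "y \<in> U" "f N y \<in> U"
    using recurrence_ge[OF assms(1,2)] .
  then show thesis
    using that[of "f N y" y] f_neq absorb[of n N y] assms(3) by auto
qed

lemma realizes_two_leaf_positions:
  assumes forest: "forest E W" "l \<notin> W" "\<forall>i v. E l = Some (i, v) \<longrightarrow> v \<in> W"
    and x: "realizes E (insert l W) x"
    and U: "\<And>w. w \<in> insert l W \<Longrightarrow> open (U w)" "\<And>w. w \<in> insert l W \<Longrightarrow> x w \<in> U w"
  obtains x' y z where "y \<in> U l" "z \<in> U l" "y \<noteq> z" "\<And>w. w \<in> W \<Longrightarrow> x' w \<in> U w"
    "realizes E (insert l W) (x'(l := y))" "realizes E (insert l W) (x'(l := z))"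
proof (cases "E l")
  case None
  obtain n y where y: "y \<in> D n" "y \<in> U l" "f n y \<in> U l"
    using recurrence[of "U l"] U[of l] by blast
  have "realizes E (insert l W) (x(l := z))" for z
    using None x by (simp add: realizes_insert_leaf[OF forest]) (simp add: realizes_def)
  then show thesis using that[of "f n y" y x] y f_neq U(2) by blast
next
  case (Some edge)
  then obtain i v where edge: "E l = Some (i, v)" by (cases edge) simp
  then have image: "x l \<in> D i" "f i (x l) = x v" "v \<in> W"
    using x forest(3) by (auto simp: realizes_def)
  have "realizes E W x" using x by (simp add: realizes_def)
  then have "\<forall>\<^sub>F y in nhds (x v). \<exists>x'. realizes E W x' \<and> x' v = y \<and> (\<forall>w\<in>W. x' w \<in> U w)"
    using U by (intro realizes_perturb_at[OF forest(1) _ image(3)]) auto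
  then obtain B where B: "open B" "x v \<in> B"
      "\<And>y. y \<in> B \<Longrightarrow> \<exists>x'. realizes E W x' \<and> x' v = y \<and> (\<forall>w\<in>W. x' w \<in> U w)"
    unfolding eventually_nhds by blast
  define A where "A = U l \<inter> (D i \<inter> f i -` B)"
  have "open A" "A \<noteq> {}" "A \<subseteq> D i"
    using U[of l] open_preimage[OF B(1)] image B(2) by (auto simp: A_def)
  then obtain y z where yz: "y \<in> A" "z \<in> A" "y \<noteq> z" "f i y = f i z"
    by (rule two_preimages)
  then obtain x' where "realizes E W x'" "x' v = f i y" "\<forall>w\<in>W. x' w \<in> U w"
    using B(3)[of "f i y"] by (auto simp: A_def)
  then show thesis
    using yz edge by (intro that[of y z x']) (auto simp: realizes_insert_leaf[OF forest] A_def)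
qed

text \<open>A collision of the leaf with another vertex u is resolved by moving its parent to a point with
  two preimages near the leaf: at most one of them is the new position of u.\<close>
lemma realizes_insert_leaf_inj:
  assumes forest: "forest E W" "l \<notin> W" "\<forall>i v. E l = Some (i, v) \<longrightarrow> v \<in> W"
    and x: "realizes E (insert l W) x" "inj_on x W"
    and U: "\<And>w. w \<in> insert l W \<Longrightarrow> open (U w)" "\<And>w. w \<in> insert l W \<Longrightarrow> x w \<in> U w"
  shows "\<exists>x'. realizes E (insert l W) x' \<and> inj_on x' (insert l W) \<and> (\<forall>w\<in>insert l W. x' w \<in> U w)"
proof (cases "x l \<in> x ` W")
  case False
  then show ?thesis using x U forest(2) by (intro exI[of _ x]) auto
next
  case True
  then obtain u where u: "u \<in> W" "x u = x l" by auto
  obtain V where V: "\<And>w. w \<in> W \<Longrightarrow> open (V w)" "\<And>w. w \<in> W \<Longrightarrow> x w \<in> V w"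
    and disjoint: "disjoint_family_on V W"
    using finite_imp_disjoint_open_nhds[OF forest_finite[OF forest(1)] x(2)] by metis
  define U' where "U' w = U w \<inter> V (if w = l then u else w)" for w
  have "open (U' w) \<and> x w \<in> U' w" if "w \<in> insert l W" for w
    using that U[OF that] V[of w] V[OF u(1)] u(2) by (auto simp: U'_def)
  then obtain x' y z where yz: "y \<in> U' l" "z \<in> U' l" "y \<noteq> z"
    and x': "\<And>w. w \<in> W \<Longrightarrow> x' w \<in> U' w"
    and realizes: "realizes E (insert l W) (x'(l := y))" "realizes E (insert l W) (x'(l := z))"
    using realizes_two_leaf_positions[OF forest x(1), of U'] by metis
  obtain p where p: "p \<in> U' l" "p \<noteq> x' u" "realizes E (insert l W) (x'(l := p))"
    using yz realizes by metis
  have x'_UV: "x' w \<in> U w" "x' w \<in> V w" if "w \<in> W" for w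
    using x'[OF that] that forest(2) by (auto simp: U'_def split: if_splits)
  have p_UV: "p \<in> U l" "p \<in> V u" using p(1) by (auto simp: U'_def)
  have "inj_on x' W"
    using x'_UV(2) disjoint by (intro inj_onI) (force simp: disjoint_family_on_def)
  moreover have "p \<noteq> x' w" if "w \<in> W" for w
    using p(2) p_UV(2) x'_UV(2)[OF that] that u(1) disjoint
    by (cases "w = u") (auto simp: disjoint_family_on_def)
  ultimately have "inj_on (x'(l := p)) (insert l W)"
    using forest(2) by (auto simp: inj_on_def)
  then show ?thesis using p(3) p_UV(1) x'_UV(1) by (intro exI[of _ "x'(l := p)"]) auto
qed

lemma realizes_perturb_inj:
  assumes "forest E W" "realizes E W x"
    and "\<And>w. w \<in> W \<Longrightarrow> open (U w)" "\<And>w. w \<in> W \<Longrightarrow> x w \<in> U w"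
  shows "\<exists>x'. realizes E W x' \<and> inj_on x' W \<and> (\<forall>w\<in>W. x' w \<in> U w)"
  using assms
proof (induction arbitrary: U rule: forest.induct)
  case (leaf W l)
  obtain U' where U': "\<And>w. w \<in> W \<Longrightarrow> open (U' w)" "\<And>w. w \<in> W \<Longrightarrow> x w \<in> U' w" "\<And>w. U' w \<subseteq> U w"
    and lift: "\<And>x'. realizes E W x' \<Longrightarrow> (\<And>w. w \<in> W \<Longrightarrow> x' w \<in> U' w) \<Longrightarrow>
      \<exists>y\<in>U l. realizes E (insert l W) (x'(l := y))"
    using realizes_lift_leaf[OF leaf.hyps leaf.prems] by metis
  have "realizes E W x" using leaf.prems(1) by (simp add: realizes_def)
  then obtain x' where x': "realizes E W x'" "inj_on x' W" "\<forall>w\<in>W. x' w \<in> U' w"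
    using leaf.IH U'(1,2) by blast
  then obtain y where y: "y \<in> U l" "realizes E (insert l W) (x'(l := y))"
    using lift by blast
  show ?case
  proof (rule realizes_insert_leaf_inj[OF leaf.hyps y(2)])
    show "inj_on (x'(l := y)) W"
      using x'(2) leaf.hyps(2) by (auto simp: inj_on_def)
    show "(x'(l := y)) w \<in> U w" if "w \<in> insert l W" for w
      using x'(3) y(1) U'(3) that by auto
  qed (rule leaf.prems(2))
qed (simp add: realizes_def)

end

subsection \<open>The maps generating the graph on the Cantor space\<close>

lemma strict_mono_q: "strict_mono q"
proof (rule strict_monoI_Suc)
  show "q n < q (Suc n)" for n
    unfolding q.simps using less_exp[of "q n"] by linarith
qed

lemma le_q: "n \<le> q n"
  by (rule strict_mono_imp_increasing[OF strict_mono_q])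

lemma pow_q_le_q: "m < n \<Longrightarrow> 3 * 2 ^ q m \<le> q n"
  using strict_mono_less_eq[OF strict_mono_q, of "Suc m" n] by simp

lemma pow_q_less_q: "m < n \<Longrightarrow> 2 ^ q m < q n"
  using pow_q_le_q[of m n] zero_less_power[of "2::nat" "q m"] by linarith

declare psi.simps [simp del]

lemma length_psi: "length (psi n) \<le> n"
proof (induction n rule: less_induct)
  case (less n)
  show ?case
  proof (cases "n = 0")
    case False
    then have "(n + 1) div 2 - 1 < n" by simp
    from less.IH[OF this] False show ?thesis
      by (subst psi.simps) simp
  qed (subst psi.simps, simp)
qed

lemma length_t [simp]: "length (t n) = 2 ^ q n"
proof -
  have "length (psi n) \<le> 2 ^ q n"
    using length_psi[of n] le_q[of n] less_exp[of "q n"] by linarith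
  then show ?thesis by (simp add: t_def)
qed

lemma Nbhd_nonempty: "Nbhd s \<noteq> {}"
proof -
  have "(!) s \<in> Nbhd s" by (simp add: Nbhd_def)
  then show ?thesis by blast
qed

definition dom_g :: "nat \<Rightarrow> (nat \<Rightarrow> bool) set" where
  "dom_g n = Nbhd (t n @ [False])"

lemma mem_dom_g: "\<alpha> \<in> dom_g n \<longleftrightarrow> \<alpha> \<in> Nbhd (t n) \<and> \<not> \<alpha> (2 ^ q n)"
  by (auto simp: dom_g_def Nbhd_def nth_append less_Suc_eq)

lemma mem_S: "k \<in> S n \<longleftrightarrow> 0 < k \<and> 2 ^ q n dvd k"
  by (auto simp: S_def dvd_def)

lemma theta_less: "k < 2 ^ q n \<Longrightarrow> theta n k = k"
  by (auto simp: theta_def S_def)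

lemma theta_le: "theta n k \<le> 2 * k + 2 ^ q n"
  by (auto simp: theta_def S_def algebra_simps)

lemma theta_notin_S:
  assumes "m < n" shows "theta m k \<notin> S n"
proof -
  have double: "2 ^ q m * 2 dvd (2::nat) ^ q n"
    using strict_mono_less[OF strict_mono_q, of m n] assms
    by (metis Suc_leI le_imp_power_dvd power_Suc2)
  show ?thesis
  proof (cases "k \<in> S m")
    case True
    have "\<not> 2 ^ q m * 2 dvd 2 ^ q m * (2 * (k div 2 ^ q m) + 1)"
      by (subst dvd_times_left_cancel_iff) simp_all
    then show ?thesis
      using True double by (auto simp: theta_def mem_S[of _ n] dest: dvd_trans)
  next
    case False
    then show ?thesis
      using double by (auto simp: theta_def mem_S dest: dvd_trans dvd_mult_left)
  qed
qed

lemma g_less: "k < 2 ^ q n \<Longrightarrow> g n \<alpha> k = \<alpha> k"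
  by (simp add: g_def theta_less)

lemma g_pivot: "g n \<alpha> (2 ^ q n)"
  by (simp add: g_def)

lemma g_mem_Nbhd_t: "g n \<alpha> \<in> Nbhd (t n) \<longleftrightarrow> \<alpha> \<in> Nbhd (t n)"
  by (simp add: Nbhd_def g_less)

lemma g_absorb:
  assumes "m < n" shows "g m (g n \<alpha>) = g m \<alpha>"
proof
  fix k
  have "theta m k \<noteq> 2 ^ q n" "theta n (theta m k) = theta m k"
    using theta_notin_S[OF assms, of k] by (auto simp: mem_S theta_def[of n])
  then show "g m (g n \<alpha>) k = g m \<alpha> k"
    by (simp add: g_def)
qed

definition truncate :: "nat \<Rightarrow> (nat \<Rightarrow> bool) \<Rightarrow> nat \<Rightarrow> bool" where
  "truncate L \<alpha> i \<longleftrightarrow> i < L \<and> \<alpha> i"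

lemma truncate_eq_iff: "truncate L \<alpha> = truncate L \<beta> \<longleftrightarrow> (\<forall>i<L. \<alpha> i = \<beta> i)"
  by (auto simp: truncate_def fun_eq_iff)

lemma truncate_eq_mono: "truncate L \<alpha> = truncate L \<beta> \<Longrightarrow> K \<le> L \<Longrightarrow> truncate K \<alpha> = truncate K \<beta>"
  by (simp add: truncate_eq_iff)

lemma finite_range_truncate: "finite (range (truncate L))"
proof (rule finite_surj)
  show "range (truncate L) \<subseteq> (\<lambda>A i. i \<in> A) ` Pow {..<L}"
  proof
    fix \<beta> assume "\<beta> \<in> range (truncate L)"
    then have "\<beta> = (\<lambda>i. i \<in> {i. \<beta> i})" "{i. \<beta> i} \<subseteq> {..<L}"
      by (auto simp: truncate_def)
    then show "\<beta> \<in> (\<lambda>A i. i \<in> A) ` Pow {..<L}" by blast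
  qed
qed simp

lemma continuous_on_if_truncate_invariant:
  fixes x :: "(nat \<Rightarrow> bool) \<Rightarrow> 'a::topological_space"
  assumes "\<And>\<alpha> \<beta>. truncate L \<alpha> = truncate L \<beta> \<Longrightarrow> x \<alpha> = x \<beta>"
  shows "continuous_on A x"
  unfolding continuous_on_topological
proof (intro ballI allI impI)
  fix \<alpha> B assume "x \<alpha> \<in> B"
  have "open {\<beta>. \<forall>i\<in>{..<L}. \<beta> i \<in> {\<alpha> i}}"
    using product_topology_basis'[of "{..<L}" "\<lambda>i. {\<alpha> i}" "\<lambda>i. i"] by (simp add: open_discrete)
  moreover have "x \<beta> \<in> B" if "\<forall>i\<in>{..<L}. \<beta> i \<in> {\<alpha> i}" for \<beta>
    using assms[of \<beta> \<alpha>] that \<open>x \<alpha> \<in> B\<close> by (simp add: truncate_eq_iff)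
  ultimately show "\<exists>U. open U \<and> \<alpha> \<in> U \<and> (\<forall>\<beta>\<in>A. \<beta> \<in> U \<longrightarrow> x \<beta> \<in> B)"
    by (intro exI[of _ "{\<beta>. \<forall>i\<in>{..<L}. \<beta> i \<in> {\<alpha> i}}"]) auto
qed

lemma cantor_top_eq_euclidean: "cantor_top = euclidean"
proof -
  have "(discrete_topology UNIV :: bool topology) = euclidean"
    by (simp add: topology_eq open_discrete)
  then show ?thesis by (simp add: cantor_top_def euclidean_product_topology)
qed

lemma Nbhd_t_truncate_eq:
  "\<alpha> \<in> Nbhd (t n) \<Longrightarrow> \<beta> \<in> Nbhd (t n) \<Longrightarrow> truncate (2 ^ q n) \<alpha> = truncate (2 ^ q n) \<beta>"
  by (simp add: Nbhd_def truncate_eq_iff)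

lemma truncate_mem_dom_g: "2 ^ q m < L \<Longrightarrow> truncate L \<alpha> \<in> dom_g m \<longleftrightarrow> \<alpha> \<in> dom_g m"
  by (simp add: truncate_def mem_dom_g Nbhd_def)

lemma g_mem_dom_g: "m < n \<Longrightarrow> g n \<alpha> \<in> dom_g m \<longleftrightarrow> \<alpha> \<in> dom_g m"
  using strict_mono_less[OF strict_mono_q, of m n]
  by (simp add: mem_dom_g Nbhd_def g_less less_trans[OF _ power_strict_increasing])

subsection \<open>The forest of largest indices\<close>

primrec top_index :: "nat \<Rightarrow> (nat \<Rightarrow> bool) \<Rightarrow> nat option" where
  "top_index 0 \<alpha> = None"
| "top_index (Suc n) \<alpha> = (if \<alpha> \<in> dom_g n then Some n else top_index n \<alpha>)"

lemma top_index_SomeD: "top_index n \<alpha> = Some m \<Longrightarrow> m < n \<and> \<alpha> \<in> dom_g m"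
  by (induction n) (auto split: if_splits)

lemma top_index_ge: "m < n \<Longrightarrow> \<alpha> \<in> dom_g m \<Longrightarrow> \<exists>M\<ge>m. top_index n \<alpha> = Some M"
  by (induction n) (auto simp: less_Suc_eq intro: less_imp_le)

lemma top_index_truncate: "q n \<le> L \<Longrightarrow> top_index n (truncate L \<alpha>) = top_index n \<alpha>"
proof (induction n)
  case (Suc n)
  then have "2 ^ q n < L" using pow_q_less_q[of n "Suc n"] by linarith
  moreover have "q n \<le> L" using calculation less_exp[of "q n"] by linarith
  ultimately show ?case by (simp add: Suc.IH truncate_mem_dom_g)
qed simp

definition step :: "nat \<Rightarrow> (nat \<Rightarrow> bool) \<Rightarrow> nat \<Rightarrow> bool" where
  "step n \<alpha> = (case top_index n \<alpha> of None \<Rightarrow> \<alpha> | Some m \<Rightarrow> g m \<alpha>)"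

lemma step_None: "top_index n \<alpha> = None \<Longrightarrow> step n \<alpha> = \<alpha>"
  by (simp add: step_def)

lemma step_Some: "top_index n \<alpha> = Some m \<Longrightarrow> step n \<alpha> = g m \<alpha>"
  by (simp add: step_def)

text \<open>The maps g only move upwards in the lexicographic order, so each of them is used at most once
  along an orbit of \<^const>\<open>step\<close>.\<close>
definition lex_above :: "bool list \<Rightarrow> (nat \<Rightarrow> bool) \<Rightarrow> bool" where
  "lex_above s \<alpha> \<longleftrightarrow> (\<exists>k<length s. (\<forall>i<k. \<alpha> i = s ! i) \<and> \<alpha> k \<and> \<not> s ! k)"

lemma lex_above_truncate: "length s \<le> L \<Longrightarrow> lex_above s (truncate L \<alpha>) \<longleftrightarrow> lex_above s \<alpha>"
  unfolding lex_above_def truncate_def by (intro ex_cong conj_cong refl all_cong) auto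

lemma lex_above_g:
  assumes "lex_above s \<alpha>" "\<alpha> \<in> dom_g m" shows "lex_above s (g m \<alpha>)"
proof -
  obtain k where k: "k < length s" "\<forall>i<k. \<alpha> i = s ! i" "\<alpha> k" "\<not> s ! k"
    using assms(1) by (auto simp: lex_above_def)
  have pivot: "\<not> \<alpha> (2 ^ q m)" using assms(2) by (simp add: mem_dom_g)
  then consider (before) "k < 2 ^ q m" | (after) "2 ^ q m < k" using k(3) by (metis linorder_neqE_nat)
  then show ?thesis
  proof cases
    case before
    then show ?thesis
      using k unfolding lex_above_def by (intro exI[of _ k]) (simp add: g_less)
  next
    case after
    then show ?thesis
      using k pivot g_pivot[of m \<alpha>] unfolding lex_above_def
      by (intro exI[of _ "2 ^ q m"]) (auto simp: g_less)
  qed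
qed

lemma lex_above_g_self: "\<alpha> \<in> dom_g m \<Longrightarrow> lex_above (t m @ [False]) (g m \<alpha>)"
  unfolding lex_above_def
  by (intro exI[of _ "2 ^ q m"]) (simp add: g_pivot g_less mem_dom_g Nbhd_def nth_append)

lemma not_lex_above_dom_g: "\<alpha> \<in> dom_g m \<Longrightarrow> \<not> lex_above (t m @ [False]) \<alpha>"
  by (auto simp: lex_above_def dom_g_def Nbhd_def)

lemma lex_above_step: "lex_above s \<alpha> \<Longrightarrow> lex_above s (step n \<alpha>)"
  by (auto simp: step_def lex_above_g dest: top_index_SomeD split: option.split)

definition height :: "nat \<Rightarrow> (nat \<Rightarrow> bool) \<Rightarrow> nat" where
  "height n \<alpha> = card {m. m < n \<and> \<not> lex_above (t m @ [False]) \<alpha>}"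

lemma height_le: "height n \<alpha> \<le> n"
proof -
  have "height n \<alpha> \<le> card {..<n}" unfolding height_def by (rule card_mono) auto
  then show ?thesis by simp
qed

lemma height_truncate: "height n (truncate (q n) \<alpha>) = height n \<alpha>"
proof -
  have "lex_above (t m @ [False]) (truncate (q n) \<alpha>) \<longleftrightarrow> lex_above (t m @ [False]) \<alpha>" if "m < n" for m
    using pow_q_less_q[OF that] by (intro lex_above_truncate) simp
  then show ?thesis unfolding height_def by (metis (no_types, lifting))
qed

lemma height_step_less:
  assumes "top_index n \<alpha> = Some m" shows "height n (step n \<alpha>) < height n \<alpha>"
  unfolding height_def
proof (rule psubset_card_mono)
  have "m < n" "\<alpha> \<in> dom_g m" using top_index_SomeD[OF assms] by auto
  then have "m \<in> {m. m < n \<and> \<not> lex_above (t m @ [False]) \<alpha>}"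
    "m \<notin> {m. m < n \<and> \<not> lex_above (t m @ [False]) (step n \<alpha>)}"
    using not_lex_above_dom_g lex_above_g_self by (auto simp: step_Some[OF assms])
  then show "{m. m < n \<and> \<not> lex_above (t m @ [False]) (step n \<alpha>)}
      \<subset> {m. m < n \<and> \<not> lex_above (t m @ [False]) \<alpha>}"
    using lex_above_step by blast
qed simp

definition itinerary :: "nat \<Rightarrow> (nat \<Rightarrow> bool) \<Rightarrow> nat \<Rightarrow> nat \<Rightarrow> bool" where
  "itinerary n \<alpha> j = truncate (q n) ((step n ^^ j) \<alpha>)"

lemma itinerary_0: "itinerary n \<alpha> 0 = truncate (q n) \<alpha>"
  by (simp add: itinerary_def)

lemma itinerary_step: "itinerary n (step n \<alpha>) = (\<lambda>j. itinerary n \<alpha> (Suc j))"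
  by (simp add: itinerary_def fun_eq_iff funpow_swap1)

lemma itinerary_eq_imp_truncate_eq:
  "itinerary n \<alpha> = itinerary n \<beta> \<Longrightarrow> truncate (q n) \<alpha> = truncate (q n) \<beta>"
  by (metis itinerary_0)

lemma itinerary_eq_iff:
  "itinerary n \<alpha> = itinerary n \<beta> \<longleftrightarrow>
    truncate (q n) \<alpha> = truncate (q n) \<beta> \<and> itinerary n (step n \<alpha>) = itinerary n (step n \<beta>)"
proof (intro iffI conjI)
  assume "truncate (q n) \<alpha> = truncate (q n) \<beta> \<and> itinerary n (step n \<alpha>) = itinerary n (step n \<beta>)"
  then have "itinerary n \<alpha> j = itinerary n \<beta> j" for j
    by (cases j) (auto simp: itinerary_0 itinerary_step dest: fun_cong)
  then show "itinerary n \<alpha> = itinerary n \<beta>" by blast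
qed (auto simp: itinerary_step intro: itinerary_eq_imp_truncate_eq)

lemma itinerary_None:
  assumes "top_index n \<alpha> = None" shows "itinerary n \<alpha> j = truncate (q n) \<alpha>"
proof -
  have "(step n ^^ j) \<alpha> = \<alpha>" by (induction j) (simp_all add: step_None[OF assms])
  then show ?thesis by (simp add: itinerary_def)
qed

lemma truncate_step_eq:
  assumes "truncate (2 * L + q n div 3) \<alpha> = truncate (2 * L + q n div 3) \<beta>" "q n \<le> L"
  shows "truncate L (step n \<alpha>) = truncate L (step n \<beta>)"
proof -
  have "truncate (q n) \<alpha> = truncate (q n) \<beta>"
    by (rule truncate_eq_mono[OF assms(1)]) (use assms(2) in linarith)
  then have same_top: "top_index n \<alpha> = top_index n \<beta>"
    by (metis top_index_truncate order_refl)
  show ?thesis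
  proof (cases "top_index n \<beta>")
    case None
    then show ?thesis
      using same_top truncate_eq_mono[OF assms(1), of L] by (simp add: step_None)
  next
    case (Some m)
    then have "2 ^ q m \<le> q n div 3"
      using pow_q_le_q[of m n] top_index_SomeD by fastforce
    then have "theta m k < 2 * L + q n div 3" if "k < L" for k
      using theta_le[of m k] that by linarith
    then show ?thesis
      using assms(1) same_top Some by (simp add: step_Some truncate_eq_iff g_def)
  qed
qed

text \<open>Applying some g m with m < n at most doubles the positions read, up to an error of
  \<^term>\<open>q n div 3\<close>; q grows fast enough to afford n such steps.\<close>
lemma itinerary_eq_if_truncate_eq_height:
  assumes "truncate L \<alpha> = truncate L \<beta>" "2 ^ height n \<alpha> * (4 * (q n div 3)) \<le> L + q n div 3"
  shows "itinerary n \<alpha> = itinerary n \<beta>"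
  using assms
proof (induction "height n \<alpha>" arbitrary: \<alpha> \<beta> L rule: less_induct)
  case less
  define c where "c = q n div 3"
  have q_eq: "q n = 3 * c" by (cases n) (simp_all add: c_def)
  have "4 * c \<le> 2 ^ height n \<alpha> * (4 * c)" by simp
  then have "q n \<le> L" using less.prems(2)[folded c_def] q_eq by linarith
  then have same_q: "truncate (q n) \<alpha> = truncate (q n) \<beta>"
    by (rule truncate_eq_mono[OF less.prems(1)])
  then have same_top: "top_index n \<alpha> = top_index n \<beta>"
    by (metis top_index_truncate order_refl)
  show ?case
  proof (cases "top_index n \<alpha>")
    case None
    then show ?thesis
      using same_top same_q by (simp add: fun_eq_iff[of "itinerary n \<alpha>"] itinerary_None)
  next
    case (Some m)
    define K where "K = 2 ^ height n (step n \<alpha>) * (4 * c) - c"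
    have "4 * c \<le> 2 ^ height n (step n \<alpha>) * (4 * c)" by simp
    then have K: "2 ^ height n (step n \<alpha>) * (4 * c) = K + c" "q n \<le> K"
      unfolding K_def q_eq by linarith+
    have lower: "height n (step n \<alpha>) < height n \<alpha>" by (rule height_step_less[OF Some])
    then have "2 * 2 ^ height n (step n \<alpha>) \<le> (2::nat) ^ height n \<alpha>"
      by (metis Suc_leI power_Suc power_increasing one_le_numeral)
    then have "2 * 2 ^ height n (step n \<alpha>) * (4 * c) \<le> 2 ^ height n \<alpha> * (4 * c)"
      by (rule mult_le_mono1)
    then have "2 * K + c \<le> L" using K(1) less.prems(2)[folded c_def] by linarith
    then have "truncate (2 * K + c) \<alpha> = truncate (2 * K + c) \<beta>"
      by (rule truncate_eq_mono[OF less.prems(1)])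
    then have "truncate K (step n \<alpha>) = truncate K (step n \<beta>)"
      using K(2) unfolding c_def by (rule truncate_step_eq)
    then have "itinerary n (step n \<alpha>) = itinerary n (step n \<beta>)"
      by (rule less.hyps[OF lower]) (simp add: K(1) flip: c_def)
    with same_q show ?thesis by (simp add: itinerary_eq_iff[of n \<alpha> \<beta>])
  qed
qed

lemma pow_mult_q_div_3_le: "2 ^ n * (4 * (q n div 3)) \<le> 2 ^ q n"
proof (cases n)
  case (Suc p)
  have "p + 1 \<le> q p + 1" "q p + 1 \<le> 2 ^ q p"
    using le_q[of p] less_exp[of "q p"] by linarith+
  then have "n + 2 + q p \<le> q n" using Suc by simp
  then have "(2::nat) ^ (n + 2 + q p) \<le> 2 ^ q n" by (rule power_increasing) simp
  then show ?thesis using Suc by (simp add: power_add)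
qed simp

lemma itinerary_eq_if_truncate_eq:
  assumes "truncate (2 ^ q n) \<alpha> = truncate (2 ^ q n) \<beta>"
  shows "itinerary n \<alpha> = itinerary n \<beta>"
proof (rule itinerary_eq_if_truncate_eq_height[OF assms])
  have "2 ^ height n \<alpha> * (4 * (q n div 3)) \<le> 2 ^ n * (4 * (q n div 3))"
    using power_increasing[OF height_le, of "2::nat" n \<alpha>] by simp
  then show "2 ^ height n \<alpha> * (4 * (q n div 3)) \<le> 2 ^ q n + q n div 3"
    using pow_mult_q_div_3_le[of n] by linarith
qed

lemma itinerary_eq_on_Nbhd_t:
  "\<alpha> \<in> Nbhd (t n) \<Longrightarrow> \<beta> \<in> Nbhd (t n) \<Longrightarrow> itinerary n \<alpha> = itinerary n \<beta>"
  by (intro itinerary_eq_if_truncate_eq Nbhd_t_truncate_eq)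

lemma itinerary_Suc_eqD:
  assumes "itinerary (Suc n) \<alpha> = itinerary (Suc n) \<beta>" shows "itinerary n \<alpha> = itinerary n \<beta>"
  using pow_q_less_q[of n "Suc n"] itinerary_eq_imp_truncate_eq[OF assms]
  by (intro itinerary_eq_if_truncate_eq) (metis lessI less_imp_le truncate_eq_mono)

lemma finite_range_itinerary: "finite (range (itinerary n))"
proof (rule finite_surj[OF finite_range_truncate])
  have "itinerary n \<alpha> = itinerary n (truncate (2 ^ q n) \<alpha>)" for \<alpha>
    by (rule itinerary_eq_if_truncate_eq) (simp add: truncate_eq_iff truncate_def)
  then show "range (itinerary n) \<subseteq> itinerary n ` range (truncate (2 ^ q n))" by blast
qed

definition hits :: "nat \<Rightarrow> (nat \<Rightarrow> bool) \<Rightarrow> bool" where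
  "hits n \<alpha> \<longleftrightarrow> (\<exists>j. (step (Suc n) ^^ j) \<alpha> \<in> dom_g n)"

lemma hits_iff_itinerary: "hits n \<alpha> \<longleftrightarrow> (\<exists>j. itinerary (Suc n) \<alpha> j \<in> dom_g n)"
  using truncate_mem_dom_g[OF pow_q_less_q[of n "Suc n"]] by (simp add: hits_def itinerary_def)

lemma hits_dom_g: "\<alpha> \<in> dom_g n \<Longrightarrow> hits n \<alpha>"
  unfolding hits_def by (rule exI[of _ 0]) simp

lemma not_hits_g:
  assumes "\<alpha> \<in> dom_g n" shows "\<not> hits n (g n \<alpha>)"
proof -
  have "lex_above (t n @ [False]) ((step (Suc n) ^^ j) (g n \<alpha>))" for j
    by (induction j) (simp_all add: lex_above_g_self[OF assms] lex_above_step)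
  then show ?thesis using not_lex_above_dom_g unfolding hits_def by blast
qed

lemma hits_step:
  assumes "\<alpha> \<notin> dom_g n" shows "hits n (step (Suc n) \<alpha>) \<longleftrightarrow> hits n \<alpha>"
proof -
  have "hits n (step (Suc n) \<alpha>) \<longleftrightarrow> (\<exists>j. (step (Suc n) ^^ Suc j) \<alpha> \<in> dom_g n)"
    by (simp add: hits_def funpow_swap1)
  also have "\<dots> \<longleftrightarrow> hits n \<alpha>"
    unfolding hits_def using assms by (metis funpow_0 nat.exhaust)
  finally show ?thesis .
qed

text \<open>\<^term>\<open>\<phi> m\<close> is the index of the given map along which the edges of \<^term>\<open>g m\<close> are to be mapped.\<close>
definition parent :: "(nat \<Rightarrow> nat) \<Rightarrow> nat \<Rightarrow> (nat \<Rightarrow> nat \<Rightarrow> bool) \<Rightarrow>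
    (nat \<times> (nat \<Rightarrow> nat \<Rightarrow> bool)) option" where
  "parent \<phi> n w = map_option (\<lambda>m. (\<phi> m, \<lambda>j. w (Suc j))) (top_index n (w 0))"

lemma parent_itinerary:
  "parent \<phi> n (itinerary n \<alpha>) = map_option (\<lambda>m. (\<phi> m, itinerary n (g m \<alpha>))) (top_index n \<alpha>)"
proof -
  have "top_index n (itinerary n \<alpha> 0) = top_index n \<alpha>"
    by (simp add: itinerary_0 top_index_truncate)
  then show ?thesis
    by (cases "top_index n \<alpha>") (simp_all add: parent_def step_Some flip: itinerary_step)
qed

lemma forest_itineraries: "forest (parent \<phi> n) (range (itinerary n))"
proof (rule forest_if_height_decreasing[OF finite_range_itinerary])
  fix w i v assume "w \<in> range (itinerary n)" "parent \<phi> n w = Some (i, v)"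
  then obtain \<alpha> m where \<alpha>: "w = itinerary n \<alpha>" "v = itinerary n (step n \<alpha>)" "top_index n \<alpha> = Some m"
    by (auto simp: parent_itinerary step_Some)
  have "height n (itinerary n \<beta> 0) = height n \<beta>" for \<beta>
    by (simp add: itinerary_0 height_truncate)
  then show "v \<in> range (itinerary n) \<and> height n (v 0) < height n (w 0)"
    using height_step_less[OF \<alpha>(3)] by (simp add: \<alpha>(1,2))
qed

subsection \<open>Approximations of the embedding\<close>

locale complete_absorbing_maps = absorbing_maps D f
  for D :: "nat \<Rightarrow> 'a::complete_space set" and f :: "nat \<Rightarrow> 'a \<Rightarrow> 'a"
begin

definition approximates :: "(nat \<Rightarrow> nat) \<Rightarrow> nat \<Rightarrow> ((nat \<Rightarrow> bool) \<Rightarrow> 'a) \<Rightarrow> bool" where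
  "approximates \<phi> n x \<longleftrightarrow>
    (\<forall>\<alpha> \<beta>. itinerary n \<alpha> = itinerary n \<beta> \<longrightarrow> x \<alpha> = x \<beta>) \<and>
    (\<forall>\<alpha> m. top_index n \<alpha> = Some m \<longrightarrow> (x \<alpha>, x (g m \<alpha>)) \<in> graph_of (D (\<phi> m)) (f (\<phi> m)))"

lemma approximates_itinerary: "approximates \<phi> n x \<Longrightarrow> itinerary n \<alpha> = itinerary n \<beta> \<Longrightarrow> x \<alpha> = x \<beta>"
  unfolding approximates_def by blast

lemma approximates_edge:
  "approximates \<phi> n x \<Longrightarrow> top_index n \<alpha> = Some m \<Longrightarrow> x \<alpha> \<in> D (\<phi> m) \<and> f (\<phi> m) (x \<alpha>) = x (g m \<alpha>)"
  unfolding approximates_def mem_graph_of by metis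

lemma approximates_cong:
  assumes "\<And>m. m < n \<Longrightarrow> \<phi> m = \<psi> m" shows "approximates \<phi> n x \<longleftrightarrow> approximates \<psi> n x"
proof -
  have "\<phi> m = \<psi> m" if "top_index n \<alpha> = Some m" for \<alpha> m
    using assms top_index_SomeD[OF that] by blast
  then show ?thesis by (simp add: approximates_def)
qed

lemma approximates_iff_realizes:
  "approximates \<phi> n x \<longleftrightarrow>
    (\<exists>z. x = z \<circ> itinerary n \<and> realizes (parent \<phi> n) (range (itinerary n)) z)"
proof -
  have edges: "realizes (parent \<phi> n) (range (itinerary n)) z \<longleftrightarrow>
      (\<forall>\<alpha> m. top_index n \<alpha> = Some m \<longrightarrow>
        (z (itinerary n \<alpha>), z (itinerary n (g m \<alpha>))) \<in> graph_of (D (\<phi> m)) (f (\<phi> m)))" for z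
    by (simp add: realizes_def parent_itinerary) blast
  show ?thesis
  proof
    assume x: "approximates \<phi> n x"
    then obtain z where z: "x = z \<circ> itinerary n"
      unfolding approximates_def function_factors_left by blast
    with x have "realizes (parent \<phi> n) (range (itinerary n)) z"
      unfolding approximates_def edges z comp_apply by blast
    with z show "\<exists>z. x = z \<circ> itinerary n \<and> realizes (parent \<phi> n) (range (itinerary n)) z"
      by blast
  next
    assume "\<exists>z. x = z \<circ> itinerary n \<and> realizes (parent \<phi> n) (range (itinerary n)) z"
    then show "approximates \<phi> n x"
      by (auto simp: approximates_def edges)
  qed
qed

lemma approximates_perturb_at:
  assumes "approximates \<phi> n x" "e > 0"
  shows "\<forall>\<^sub>F y in nhds (x \<alpha>). \<exists>x'. approximates \<phi> n x' \<and> x' \<alpha> = y \<and> (\<forall>\<beta>. dist (x' \<beta>) (x \<beta>) < e)"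
proof -
  obtain z where z: "x = z \<circ> itinerary n" "realizes (parent \<phi> n) (range (itinerary n)) z"
    using assms(1) approximates_iff_realizes by blast
  have "\<forall>\<^sub>F y in nhds (z (itinerary n \<alpha>)). \<exists>z'. realizes (parent \<phi> n) (range (itinerary n)) z' \<and>
      z' (itinerary n \<alpha>) = y \<and> (\<forall>w\<in>range (itinerary n). z' w \<in> ball (z w) e)"
    using assms(2) by (intro realizes_perturb_at[OF forest_itineraries z(2)]) auto
  then have "\<forall>\<^sub>F y in nhds (x \<alpha>). \<exists>z'. realizes (parent \<phi> n) (range (itinerary n)) z' \<and>
      z' (itinerary n \<alpha>) = y \<and> (\<forall>\<beta>. dist (z' (itinerary n \<beta>)) (x \<beta>) < e)"
    by (simp add: z(1) dist_commute)
  then show ?thesis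
  proof eventually_elim
    case (elim y)
    then obtain z' where z': "realizes (parent \<phi> n) (range (itinerary n)) z'"
        "z' (itinerary n \<alpha>) = y" "\<forall>\<beta>. dist (z' (itinerary n \<beta>)) (x \<beta>) < e"
      by blast
    have "approximates \<phi> n (z' \<circ> itinerary n)"
      using z'(1) approximates_iff_realizes by blast
    then show ?case
      using z'(2,3) by (intro exI[of _ "z' \<circ> itinerary n"]) simp
  qed
qed

lemma approximates_perturb_inj:
  assumes "approximates \<phi> n x" "e > 0"
  obtains x' where "approximates \<phi> n x'" "\<And>\<alpha> \<beta>. x' \<alpha> = x' \<beta> \<Longrightarrow> itinerary n \<alpha> = itinerary n \<beta>"
    "\<And>\<beta>. dist (x' \<beta>) (x \<beta>) < e"
proof -
  obtain z where z: "x = z \<circ> itinerary n" "realizes (parent \<phi> n) (range (itinerary n)) z"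
    using assms(1) approximates_iff_realizes by blast
  have "\<exists>z'. realizes (parent \<phi> n) (range (itinerary n)) z' \<and> inj_on z' (range (itinerary n)) \<and>
      (\<forall>w\<in>range (itinerary n). z' w \<in> ball (z w) e)"
    using assms(2) by (intro realizes_perturb_inj[OF forest_itineraries z(2)]) auto
  then obtain z' where z': "realizes (parent \<phi> n) (range (itinerary n)) z'"
      "inj_on z' (range (itinerary n))" "\<forall>w\<in>range (itinerary n). z' w \<in> ball (z w) e"
    by blast
  show thesis
  proof (rule that)
    show "approximates \<phi> n (z' \<circ> itinerary n)"
      using z'(1) approximates_iff_realizes by blast
  qed (use z' z(1) in \<open>auto simp: dist_commute dest: inj_onD\<close>)
qed

text \<open>The forest of stage n + 1 projects to two copies of the forest of stage n, one of them for the
  vertices whose orbit meets the domain of \<^term>\<open>g n\<close>, joined by a single new edge.\<close>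
lemma approximates_Suc_join:
  assumes x0: "approximates \<phi> n x0" and x1: "approximates \<phi> n x1"
    and new_edge: "\<And>\<alpha> \<beta>. \<alpha> \<in> Nbhd (t n) \<Longrightarrow> \<beta> \<in> Nbhd (t n) \<Longrightarrow> (x0 \<alpha>, x1 \<beta>) \<in> graph_of (D N) (f N)"
  shows "approximates (\<phi>(n := N)) (Suc n) (\<lambda>\<alpha>. if hits n \<alpha> then x0 \<alpha> else x1 \<alpha>)"
    (is "approximates _ _ ?x")
  unfolding approximates_def
proof (intro conjI allI impI)
  fix \<alpha> \<beta> assume eq: "itinerary (Suc n) \<alpha> = itinerary (Suc n) \<beta>"
  then have "hits n \<alpha> \<longleftrightarrow> hits n \<beta>" by (simp add: hits_iff_itinerary)
  then show "?x \<alpha> = ?x \<beta>"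
    using itinerary_Suc_eqD[OF eq, THEN approximates_itinerary[OF x0]]
      itinerary_Suc_eqD[OF eq, THEN approximates_itinerary[OF x1]] by simp
next
  fix \<alpha> m assume top: "top_index (Suc n) \<alpha> = Some m"
  show "(?x \<alpha>, ?x (g m \<alpha>)) \<in> graph_of (D ((\<phi>(n := N)) m)) (f ((\<phi>(n := N)) m))"
  proof (cases "\<alpha> \<in> dom_g n")
    case True
    then have "m = n" "\<alpha> \<in> Nbhd (t n)" using top by (auto simp: mem_dom_g)
    then show ?thesis
      using new_edge[of \<alpha> "g n \<alpha>"] hits_dom_g[OF True] not_hits_g[OF True] by (simp add: g_mem_Nbhd_t)
  next
    case False
    then have top_n: "top_index n \<alpha> = Some m" using top by simp
    then have "m < n" using top_index_SomeD by blast
    moreover have "hits n (g m \<alpha>) \<longleftrightarrow> hits n \<alpha>"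
      using hits_step[OF False] step_Some[OF top] by simp
    ultimately show ?thesis
      using approximates_edge[OF x0 top_n] approximates_edge[OF x1 top_n] by simp
  qed
qed

lemma approximates_Suc:
  assumes x: "approximates \<phi> n x" and e: "e > 0"
  obtains N x' where "\<And>m. m < n \<Longrightarrow> \<phi> m < N" "approximates (\<phi>(n := N)) (Suc n) x'"
    "\<And>\<beta>. dist (x' \<beta>) (x \<beta>) < e"
proof -
  obtain \<tau> where \<tau>: "\<tau> \<in> Nbhd (t n)" using Nbhd_nonempty by blast
  obtain B where B: "open B" "x \<tau> \<in> B"
    and perturb: "\<And>y. y \<in> B \<Longrightarrow> \<exists>x'. approximates \<phi> n x' \<and> x' \<tau> = y \<and> (\<forall>\<beta>. dist (x' \<beta>) (x \<beta>) < e)"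
    using approximates_perturb_at[OF x e, of \<tau>] unfolding eventually_nhds by blast
  obtain N y where N: "Suc (\<Sum>m<n. \<phi> m) \<le> N" and y: "y \<in> D N" "y \<in> B" "f N y \<in> B"
    using recurrence_ge[OF B(1)] B(2) by blast
  obtain x0 where x0: "approximates \<phi> n x0" "x0 \<tau> = y" "\<forall>\<beta>. dist (x0 \<beta>) (x \<beta>) < e"
    using perturb[OF y(2)] by blast
  obtain x1 where x1: "approximates \<phi> n x1" "x1 \<tau> = f N y" "\<forall>\<beta>. dist (x1 \<beta>) (x \<beta>) < e"
    using perturb[OF y(3)] by blast
  show thesis
  proof (rule that)
    show "\<phi> m < N" if "m < n" for m
      using member_le_sum[of m "{..<n}" \<phi>] that N by simp
    have "x0 \<alpha> = y" "x1 \<alpha> = f N y" if "\<alpha> \<in> Nbhd (t n)" for \<alpha>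
      using itinerary_eq_on_Nbhd_t[OF that \<tau>, THEN approximates_itinerary[OF x0(1)]]
        itinerary_eq_on_Nbhd_t[OF that \<tau>, THEN approximates_itinerary[OF x1(1)]] x0(2) x1(2) by simp_all
    then show "approximates (\<phi>(n := N)) (Suc n) (\<lambda>\<alpha>. if hits n \<alpha> then x0 \<alpha> else x1 \<alpha>)"
      using y(1) by (intro approximates_Suc_join x0(1) x1(1)) simp
  qed (use x0(3) x1(3) in simp)
qed

lemma approximates_all_edges:
  assumes x: "approximates \<phi> n x" and mono: "strict_mono_on {..<n} \<phi>"
    and x_mem_D: "\<And>m \<alpha>. m < n \<Longrightarrow> \<alpha> \<in> dom_g m \<Longrightarrow> x \<alpha> \<in> D (\<phi> m)"
    and "m < n" "\<alpha> \<in> dom_g m"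
  shows "f (\<phi> m) (x \<alpha>) = x (g m \<alpha>)"
  using assms(5)
proof (induction "height n \<alpha>" arbitrary: \<alpha> rule: less_induct)
  case less
  obtain M where M: "m \<le> M" "top_index n \<alpha> = Some M"
    using top_index_ge[OF assms(4) less.prems] by blast
  note edge = approximates_edge[OF x M(2)]
  show ?case
  proof (cases "m = M")
    case False
    then have "m < M" using M(1) by simp
    have "M < n" using top_index_SomeD[OF M(2)] by blast
    have g_mem: "g M \<alpha> \<in> dom_g m"
      using less.prems g_mem_dom_g[OF \<open>m < M\<close>] by simp
    have "\<phi> m < \<phi> M"
      using strict_mono_onD[OF mono, of m M] \<open>m < M\<close> \<open>M < n\<close> by simp
    then have "f (\<phi> m) (x \<alpha>) = f (\<phi> m) (f (\<phi> M) (x \<alpha>))"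
      using edge x_mem_D[OF assms(4) g_mem] x_mem_D[OF assms(4) less.prems]
      by (intro absorb[symmetric]) auto
    also have "\<dots> = f (\<phi> m) (x (g M \<alpha>))" using edge by simp
    also have "\<dots> = x (g m (g M \<alpha>))"
      using height_step_less[OF M(2)] g_mem unfolding step_Some[OF M(2)] by (rule less.hyps)
    also have "\<dots> = x (g m \<alpha>)" by (simp add: g_absorb[OF \<open>m < M\<close>])
    finally show ?thesis .
  qed (use edge in simp)
qed

lemma approximates_Suc_inj:
  assumes "approximates \<phi> n x" "e > 0"
  obtains N x' where "\<And>m. m < n \<Longrightarrow> \<phi> m < N" "approximates (\<phi>(n := N)) (Suc n) x'"
    "\<And>\<alpha> \<beta>. x' \<alpha> = x' \<beta> \<Longrightarrow> itinerary (Suc n) \<alpha> = itinerary (Suc n) \<beta>"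
    "\<And>\<beta>. dist (x' \<beta>) (x \<beta>) < e"
proof -
  have half: "e / 2 > 0" using assms(2) by simp
  obtain N y where N: "\<And>m. m < n \<Longrightarrow> \<phi> m < N"
    and y: "approximates (\<phi>(n := N)) (Suc n) y" "\<And>\<beta>. dist (y \<beta>) (x \<beta>) < e / 2"
    using approximates_Suc[OF assms(1) half] by metis
  obtain x' where x': "approximates (\<phi>(n := N)) (Suc n) x'"
      "\<And>\<alpha> \<beta>. x' \<alpha> = x' \<beta> \<Longrightarrow> itinerary (Suc n) \<alpha> = itinerary (Suc n) \<beta>"
      "\<And>\<beta>. dist (x' \<beta>) (y \<beta>) < e / 2"
    using approximates_perturb_inj[OF y(1) half] by metis
  have "dist (x' \<beta>) (x \<beta>) < e" for \<beta>
    using x'(3)[of \<beta>] y(2)[of \<beta>] dist_triangle[of "x' \<beta>" "x \<beta>" "y \<beta>"] by linarith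
  with N x'(1,2) show thesis by (rule that)
qed

text \<open>The margin e ensures that limits of later stages stay in the domains and separate the classes.\<close>
definition stage :: "nat \<Rightarrow> (nat \<Rightarrow> nat) \<Rightarrow> ((nat \<Rightarrow> bool) \<Rightarrow> 'a) \<Rightarrow> real \<Rightarrow> bool" where
  "stage n \<phi> x e \<longleftrightarrow> e > 0 \<and> strict_mono_on {..<n} \<phi> \<and> approximates \<phi> n x
     \<and> (\<forall>m<n. \<forall>\<alpha>\<in>dom_g m. ball (x \<alpha>) e \<subseteq> D (\<phi> m))
     \<and> (\<forall>\<alpha> \<beta>. itinerary n \<alpha> \<noteq> itinerary n \<beta> \<longrightarrow> e < dist (x \<alpha>) (x \<beta>))"

lemma stage_cong:
  assumes "\<And>m. m < n \<Longrightarrow> \<phi> m = \<psi> m" shows "stage n \<phi> x e \<longleftrightarrow> stage n \<psi> x e"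
  using assms approximates_cong[of n \<phi> \<psi> x] by (simp add: stage_def monotone_on_def)

lemma eventually_stage:
  assumes x: "approximates \<phi> n x" and mono: "strict_mono_on {..<n} \<phi>"
    and inj: "\<And>\<alpha> \<beta>. x \<alpha> = x \<beta> \<Longrightarrow> itinerary n \<alpha> = itinerary n \<beta>"
    and x_mem_D: "\<And>m \<alpha>. m < n \<Longrightarrow> \<alpha> \<in> dom_g m \<Longrightarrow> x \<alpha> \<in> D (\<phi> m)"
  shows "\<forall>\<^sub>F e in at_right 0. stage n \<phi> x e"
proof -
  obtain z where "x = z \<circ> itinerary n"
    using x approximates_iff_realizes by blast
  then have "range x = z ` range (itinerary n)" by (simp add: image_comp)
  then have finite: "finite (range x)" by (simp add: finite_range_itinerary)
  have "compact (x ` dom_g m)" for m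
    by (intro finite_imp_compact finite_subset[OF _ finite]) blast
  then have "\<forall>\<^sub>F e in at_right 0. \<forall>y\<in>x ` dom_g m. ball y e \<subseteq> D (\<phi> m)" if "m < n" for m
    using x_mem_D[OF that] by (intro eventually_ball_subset open_domain) auto
  then have "\<forall>\<^sub>F e in at_right 0. \<forall>m\<in>{..<n}. \<forall>y\<in>x ` dom_g m. ball y e \<subseteq> D (\<phi> m)"
    by (intro eventually_ball_finite) auto
  moreover have "\<forall>\<^sub>F e in at_right 0. \<forall>y\<in>range x. \<forall>z\<in>range x. y \<noteq> z \<longrightarrow> e < dist y z"
    by (rule eventually_less_dist[OF finite])
  moreover have "\<forall>\<^sub>F e in at_right (0::real). e > 0" by (rule eventually_at_right_less)
  ultimately show ?thesis
  proof eventually_elim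
    case (elim e)
    have "ball (x \<alpha>) e \<subseteq> D (\<phi> m)" if "m < n" "\<alpha> \<in> dom_g m" for m \<alpha>
      using elim(1) that by blast
    moreover have "e < dist (x \<alpha>) (x \<beta>)" if "itinerary n \<alpha> \<noteq> itinerary n \<beta>" for \<alpha> \<beta>
      using elim(2) inj that by blast
    ultimately show ?case using x mono elim(3) by (simp add: stage_def)
  qed
qed

lemma stage_Suc:
  assumes "stage n \<phi> x e"
  obtains \<phi>' x' e' where "stage (Suc n) \<phi>' x' e'" "\<And>m. m < n \<Longrightarrow> \<phi>' m = \<phi> m" "e' \<le> e / 2"
    "\<And>\<alpha>. dist (x' \<alpha>) (x \<alpha>) \<le> e / 4"
proof -
  have e: "e / 4 > 0" and x: "approximates \<phi> n x" and mono: "strict_mono_on {..<n} \<phi>"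
    and margin: "\<And>m \<alpha>. m < n \<Longrightarrow> \<alpha> \<in> dom_g m \<Longrightarrow> ball (x \<alpha>) e \<subseteq> D (\<phi> m)"
    using assms by (auto simp: stage_def)
  obtain N x' where N: "\<And>m. m < n \<Longrightarrow> \<phi> m < N"
    and x': "approximates (\<phi>(n := N)) (Suc n) x'"
      "\<And>\<alpha> \<beta>. x' \<alpha> = x' \<beta> \<Longrightarrow> itinerary (Suc n) \<alpha> = itinerary (Suc n) \<beta>"
    and close: "\<And>\<beta>. dist (x' \<beta>) (x \<beta>) < e / 4"
    using approximates_Suc_inj[OF x e] by metis
  have x'_mem_D: "x' \<alpha> \<in> D ((\<phi>(n := N)) m)" if m: "m < Suc n" "\<alpha> \<in> dom_g m" for m \<alpha>
  proof (cases "m = n")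
    case True
    then show ?thesis using approximates_edge[OF x'(1), of \<alpha> n] m(2) by simp
  next
    case False
    then have "ball (x \<alpha>) e \<subseteq> D (\<phi> m)" using margin m by simp
    moreover have "x' \<alpha> \<in> ball (x \<alpha>) e" using close[of \<alpha>] e by (simp add: dist_commute)
    ultimately show ?thesis using False by auto
  qed
  have "strict_mono_on {..<Suc n} (\<phi>(n := N))"
    using mono N by (auto simp: monotone_on_def less_Suc_eq)
  then have "\<forall>\<^sub>F e' in at_right 0. stage (Suc n) (\<phi>(n := N)) x' e'"
    by (intro eventually_stage x'(1,2) x'_mem_D)
  moreover have "\<forall>\<^sub>F e' in at_right 0. e' < e / 2"
    using e unfolding eventually_at_right_field by (intro exI[of _ "e / 2"]) simp
  ultimately have "\<forall>\<^sub>F e' in at_right 0. stage (Suc n) (\<phi>(n := N)) x' e' \<and> e' < e / 2"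
    by (rule eventually_conj)
  then obtain e' where e': "stage (Suc n) (\<phi>(n := N)) x' e'" "e' < e / 2"
    using eventually_happens'[OF trivial_limit_at_right_real] by blast
  show thesis
  proof (rule that[OF e'(1)])
    show "dist (x' \<alpha>) (x \<alpha>) \<le> e / 4" for \<alpha> using close[of \<alpha>] by simp
  qed (use e'(2) in simp_all)
qed

lemma stage_0: "stage 0 (\<lambda>_. 0) (\<lambda>_. undefined) 1"
proof -
  have "itinerary 0 \<alpha> = itinerary 0 \<beta>" for \<alpha> \<beta>
    by (simp add: itinerary_def truncate_def fun_eq_iff)
  then show ?thesis by (simp add: stage_def approximates_def monotone_on_def)
qed

lemma stage_sequence:
  obtains \<phi> x e where "\<And>n. stage n \<phi> (x n) (e n)" "\<And>n. e (Suc n) \<le> e n / 2"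
    "\<And>n \<alpha>. dist (x (Suc n) \<alpha>) (x n \<alpha>) \<le> e n / 4"
proof -
  define is_stage where "is_stage n = (\<lambda>(\<phi>, x, e). stage n \<phi> x e)" for n
  define refines where "refines n = (\<lambda>(\<phi> :: nat \<Rightarrow> nat, x :: (nat \<Rightarrow> bool) \<Rightarrow> 'a, e :: real) (\<phi>', x', e').
      (\<forall>m<n. \<phi>' m = \<phi> m) \<and> e' \<le> e / 2 \<and> (\<forall>\<alpha>. dist (x' \<alpha>) (x \<alpha>) \<le> e / 4))" for n
  have "\<exists>s. \<forall>n. is_stage n (s n) \<and> refines n (s n) (s (Suc n))"
  proof (rule dependent_nat_choice)
    show "\<exists>s. is_stage 0 s" using stage_0 by (auto simp: is_stage_def)
    fix s n assume "is_stage n s"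
    then obtain \<phi> x e where s: "s = (\<phi>, x, e)" and "stage n \<phi> x e"
      by (cases s) (simp add: is_stage_def)
    then obtain \<phi>' x' e' where "stage (Suc n) \<phi>' x' e'" "\<And>m. m < n \<Longrightarrow> \<phi>' m = \<phi> m"
        "e' \<le> e / 2" "\<And>\<alpha>. dist (x' \<alpha>) (x \<alpha>) \<le> e / 4"
      using stage_Suc by metis
    then show "\<exists>s'. is_stage (Suc n) s' \<and> refines n s s'"
      by (intro exI[of _ "(\<phi>', x', e')"]) (simp add: is_stage_def refines_def s)
  qed
  then obtain s where s: "\<And>n. is_stage n (s n)" "\<And>n. refines n (s n) (s (Suc n))" by blast
  define \<Phi> where "\<Phi> n = fst (s n)" for n
  define x where "x n = fst (snd (s n))" for n
  define e where "e n = snd (snd (s n))" for n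
  have s_eq: "s n = (\<Phi> n, x n, e n)" for n by (simp add: \<Phi>_def x_def e_def)
  have stages: "stage n (\<Phi> n) (x n) (e n)" for n using s(1)[of n] by (simp add: is_stage_def s_eq)
  have stable: "\<Phi> (Suc n) m = \<Phi> n m" if "m < n" for m n
    using s(2)[of n] that by (simp add: refines_def s_eq)
  define \<phi> where "\<phi> m = \<Phi> (Suc m) m" for m
  have "\<Phi> n m = \<phi> m" if "m < n" for m n
    using that
  proof (induction n)
    case (Suc n)
    then show ?case by (cases "m = n") (simp_all add: \<phi>_def stable)
  qed simp
  then have "stage n \<phi> (x n) (e n)" for n
    using stages[of n] stage_cong by blast
  then show thesis
    using s(2) by (intro that[of \<phi> x e]) (simp_all add: refines_def s_eq)
qed

lemma inj_if_near_stages: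
  assumes stage: "\<And>n. stage n \<phi> (x n) (e n)" and near: "\<And>\<alpha> n. dist (h \<alpha>) (x n \<alpha>) \<le> e n / 2"
  shows "inj h"
proof (rule injI, rule ccontr)
  fix \<alpha> \<beta> assume "h \<alpha> = h \<beta>" "\<alpha> \<noteq> \<beta>"
  then obtain i where i: "\<alpha> i \<noteq> \<beta> i" by (auto simp: fun_eq_iff)
  define n where "n = Suc i"
  have "i < q n" using le_q[of n] by (simp add: n_def)
  then have "itinerary n \<alpha> \<noteq> itinerary n \<beta>"
    using i itinerary_eq_imp_truncate_eq[of n \<alpha> \<beta>] by (auto simp: truncate_eq_iff)
  then have "e n < dist (x n \<alpha>) (x n \<beta>)" using stage[of n] by (simp add: stage_def)
  also have "\<dots> \<le> dist (h \<alpha>) (x n \<alpha>) + dist (h \<beta>) (x n \<beta>)"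
    using dist_triangle3[of "x n \<alpha>" "x n \<beta>" "h \<alpha>"] \<open>h \<alpha> = h \<beta>\<close> by simp
  also have "\<dots> \<le> e n" using near[of \<alpha> n] near[of \<beta> n] by simp
  finally show False by simp
qed

lemma edge_if_limit_of_stages:
  assumes stage: "\<And>n. stage n \<phi> (x n) (e n)" and near: "\<And>\<alpha> n. dist (h \<alpha>) (x n \<alpha>) \<le> e n / 2"
    and lim: "\<And>\<alpha>. (\<lambda>n. x n \<alpha>) \<longlonglongrightarrow> h \<alpha>" and "\<alpha> \<in> dom_g m"
  shows "(h \<alpha>, h (g m \<alpha>)) \<in> graph_of (D (\<phi> m)) (f (\<phi> m))"
proof -
  have pos: "e n > 0" and x: "approximates \<phi> n (x n)" and mono: "strict_mono_on {..<n} \<phi>"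
    and margin: "\<And>m \<alpha>. m < n \<Longrightarrow> \<alpha> \<in> dom_g m \<Longrightarrow> ball (x n \<alpha>) (e n) \<subseteq> D (\<phi> m)" for n
    using stage[of n] by (auto simp: stage_def)
  have "h \<alpha> \<in> ball (x (Suc m) \<alpha>) (e (Suc m))"
    using near[of \<alpha> "Suc m"] pos[of "Suc m"] by (simp add: dist_commute)
  then have h_mem: "h \<alpha> \<in> D (\<phi> m)" using margin[of m "Suc m"] assms(4) by blast
  have x_mem: "x n \<beta> \<in> D (\<phi> k)" if "k < n" "\<beta> \<in> dom_g k" for n k \<beta>
    using margin[OF that] pos[of n] by (meson centre_in_ball subsetD)
  have edge: "f (\<phi> m) (x n \<alpha>) = x n (g m \<alpha>)" if "m < n" for n
    using x mono x_mem that assms(4) by (rule approximates_all_edges)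
  have "\<forall>\<^sub>F n in sequentially. f (\<phi> m) (x n \<alpha>) = x n (g m \<alpha>)"
    using eventually_gt_at_top[of m] by eventually_elim (rule edge)
  moreover have "(\<lambda>n. f (\<phi> m) (x n \<alpha>)) \<longlonglongrightarrow> f (\<phi> m) (h \<alpha>)"
    by (rule filterlim_compose[OF tendsto_f[OF h_mem] lim])
  ultimately have "(\<lambda>n. x n (g m \<alpha>)) \<longlonglongrightarrow> f (\<phi> m) (h \<alpha>)"
    by (rule Lim_transform_eventually[rotated])
  then show ?thesis using LIMSEQ_unique[OF lim] h_mem by simp
qed

theorem continuous_injective_homomorphism_exists:
  obtains h where "continuous_on UNIV h" "inj h"
    "\<And>\<alpha> m. \<alpha> \<in> dom_g m \<Longrightarrow> (h \<alpha>, h (g m \<alpha>)) \<in> Af D f"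
proof -
  obtain \<phi> x e where stage: "\<And>n. stage n \<phi> (x n) (e n)" and half: "\<And>n. e (Suc n) \<le> e n / 2"
      and close: "\<And>n \<alpha>. dist (x (Suc n) \<alpha>) (x n \<alpha>) \<le> e n / 4"
    using stage_sequence by metis
  have nonneg: "0 \<le> e n" and x: "approximates \<phi> n (x n)" for n
    using stage[of n] by (simp_all add: stage_def)
  obtain h where near: "\<And>\<alpha> n. dist (h \<alpha>) (x n \<alpha>) \<le> e n / 2"
      and uniform: "uniform_limit UNIV x h sequentially"
    using uniform_limit_halving_errors[of e x, OF nonneg half close] by metis
  have "continuous_on UNIV (x n)" for n
    by (rule continuous_on_if_truncate_invariant[of "2 ^ q n"])
      (rule approximates_itinerary[OF x itinerary_eq_if_truncate_eq])
  then have "continuous_on UNIV h"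
    by (intro uniform_limit_theorem[OF _ uniform]) auto
  moreover have "inj h" by (rule inj_if_near_stages[OF stage near])
  moreover have "(h \<alpha>, h (g m \<alpha>)) \<in> Af D f" if "\<alpha> \<in> dom_g m" for \<alpha> m
    using edge_if_limit_of_stages[OF stage near tendsto_uniform_limitI[OF uniform] that]
    unfolding Af_def by blast
  ultimately show thesis by (rule that)
qed

end

lemma complex_situation_imp_complete_absorbing_maps:
  assumes "complex_situation D f"
    and "\<And>m n x. m < n \<Longrightarrow> x \<in> D n \<Longrightarrow> f n x \<in> D m \<Longrightarrow> x \<in> D m \<Longrightarrow> f m (f n x) = f m x"
  shows "complete_absorbing_maps D f"
proof
  show "f n x \<noteq> x" if "x \<in> D n" for n x
  proof
    assume "f n x = x"
    then have "(x, x) \<in> Af D f" using that by (auto simp: Af_def)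
    then show False using assms(1) by (auto simp: complex_situation_def)
  qed
qed (use assms in \<open>auto simp: complex_situation_def\<close>)

theorem theorem1p8:
  fixes D :: "nat \<Rightarrow> 'a::polish_space set" and f :: "nat \<Rightarrow> 'a \<Rightarrow> 'a"
  assumes "complex_situation D f"
    and "\<And>m n x. m < n \<Longrightarrow> x \<in> D n \<Longrightarrow> f n x \<in> D m \<Longrightarrow> x \<in> D m
           \<Longrightarrow> f m (f n x) = f m x"
  shows "\<exists>h :: (nat \<Rightarrow> bool) \<Rightarrow> 'a. continuous_map cantor_top euclidean h \<and> inj h
           \<and> G1 \<subseteq> (\<lambda>(x, y). (h x, h y)) -` Af D f"
proof -
  interpret complete_absorbing_maps D f
    using assms by (rule complex_situation_imp_complete_absorbing_maps)
  obtain h where "continuous_on UNIV h" "inj h"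
    and edge: "\<And>\<alpha> m. \<alpha> \<in> dom_g m \<Longrightarrow> (h \<alpha>, h (g m \<alpha>)) \<in> Af D f"
    using continuous_injective_homomorphism_exists by metis
  moreover have "G1 \<subseteq> (\<lambda>(x, y). (h x, h y)) -` Af D f"
    using edge by (auto simp: G1_def graph_of_def dom_g_def)
  ultimately show ?thesis
    by (auto simp: cantor_top_eq_euclidean)
qed

end
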